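(* Let $n\ge 2$, $N\ge 1$, $R>0$, let $f$ be a function analytic in a neighborhood of $\overline{B_R}\subset\mathbb{R}^n$, and let numbers $r_j$ with $0<r_1<r_2<\dots<r_N\le R$ be given. For $j=1,\dots,N$ put $\varphi^j(\theta):=f(r_j\theta)$, $\theta\in\mathbb{S}^{n-1}$, with spherical harmonic expansion $\varphi^j(\theta)=\sum_{k=0}^\infty\sum_{\ell=1}^{d_k}\varphi^j_{k,\ell}Y_{k,\ell}(\theta)$, and let $K>0$ and $\eta_j>0$ be constants such that $$|\varphi^j_{k,\ell}|\le K e^{-\eta_j k}\qquad\text{for all } k=0,1,2,\dots,\ \ell=1,\dots,d_k,\ j=1,\dots,N.$$ Suppose that $$R\cdot\max_{1\le j\le N}\left(\frac{e^{-\eta_j}}{r_j}\right)<1.$$ Then the polyharmonic function $h$ of order of polyharmonicity $N$ satisfying the interpolation problem $$h(r_j\theta)=f(r_j\theta)\qquad\text{for }\theta\in\mathbb{S}^{n-1},\ j=1,\dots,N,$$ has an $L_2$-convergent series in the ball $B_R$; that is, the series $$h(x)=\sum_{k=0}^\infty\sum_{\ell=1}^{d_k}h_{k,\ell}(r^2)\,r^k\,Y_{k,\ell}(\theta),$$ where $h_{k,\ell}$ is the polynomial of degree $\le N-1$ with $r_j^k h_{k,\ell}(r_j^2)=\varphi^j_{k,\ell}$ for $j=1,\dots,N$, converges in $L_2(B_R)$.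
   Context: $B_R=\{x\in\mathbb{R}^n: |x|<R\}$; write $x=r\theta$ with $r=|x|$, $\theta\in\mathbb{S}^{n-1}$. For each $k\ge 0$, $d_k$ is the dimension of the space of harmonic homogeneous polynomials of degree $k$ in $\mathbb{R}^n$, and $Y_{k,\ell}$, $\ell=1,\dots,d_k$, is a basis of this space, orthonormal with respect to the scalar product $\frac{1}{\omega_{n-1}}\int_{\mathbb{S}^{n-1}}u(\theta)v(\theta)\,d\theta$, where $\omega_{n-1}$ is the area of $\mathbb{S}^{n-1}$. A function $h$ is polyharmonic of order $N$ in a domain $D$ if $\Delta^N h=0$ in $D$. A function polyharmonic of order $N$ in $B_R$ has an expansion $h(x)=\sum_{k=0}^\infty\sum_{\ell=1}^{d_k}h_{k,\ell}(r^2)\,r^k\,Y_{k,\ell}(\theta)$ with $h_{k,\ell}$ polynomials of degree $\le N-1$; the interpolation problem $h(r_j\theta)=f(r_j\theta)$ on the $N$ concentric spheres is understood through this expansion, i.e. as the conditions $r_j^k h_{k,\ell}(r_j^2)=\varphi^j_{k,\ell}$ for all $k,\ell,j$, which determine each polynomial $h_{k,\ell}$ uniquely. Since each $\varphi^j$ is analytic on the sphere, constants $K>0$, $\eta_j>0$ with $|\varphi^j_{k,\ell}|\le Ke^{-\eta_j k}$ exist (known fact). *)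

theory Defs
  imports
    "HOL-Analysis.Analysis"
    "HOL-Computational_Algebra.Polynomial"
    "HOL-Library.Function_Algebras"
begin

interpretation fun_space: vector_space "\<lambda>(c::real) (f::'a \<Rightarrow> real) x. c * f x"
  by unfold_locales (auto simp: fun_eq_iff algebra_simps)

text \<open>Real analyticity: near every point of \<open>S\<close> the function is the sum of an absolutely
  convergent power series in the coordinates; \<open>\<alpha> :: 'n \<Rightarrow> nat\<close> is a multi-index.\<close>

definition real_analytic_on :: "(real ^ 'n \<Rightarrow> real) \<Rightarrow> (real ^ 'n) set \<Rightarrow> bool" where
  "real_analytic_on f S \<longleftrightarrow>
    (\<forall>a\<in>S. \<exists>c :: ('n \<Rightarrow> nat) \<Rightarrow> real.
      \<forall>\<^sub>F x in nhds a. ((\<lambda>\<alpha>. c \<alpha> * (\<Prod>i\<in>UNIV. (x $ i - a $ i) ^ \<alpha> i)) has_sum f x) UNIV)"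

definition laplacian :: "(real ^ 'n \<Rightarrow> real) \<Rightarrow> real ^ 'n \<Rightarrow> real" where
  "laplacian f x = (\<Sum>i\<in>UNIV. (deriv ^^ 2) (\<lambda>t. f (x + t *\<^sub>R axis i 1)) 0)"

definition harmonic_homogeneous :: "nat \<Rightarrow> (real ^ 'n \<Rightarrow> real) set" where
  "harmonic_homogeneous k =
    {p. real_polynomial_function p \<and>
        (\<forall>c x. p (c *\<^sub>R x) = c ^ k * p x) \<and>
        (\<forall>x. laplacian p x = 0)}"

definition harmonic_dim :: "'n::finite itself \<Rightarrow> nat \<Rightarrow> nat" where
  "harmonic_dim _ k = fun_space.dim (harmonic_homogeneous k :: (real ^ 'n \<Rightarrow> real) set)"

text \<open>Surface measure on the unit sphere: the measure of \<open>A\<close> is \<open>n\<close> times the Lebesgue measure of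
  the cone \<open>{t \<theta> | 0 < t < 1, \<theta> \<in> A}\<close> (see \<open>emeasure_sphere_measure\<close> below). This is the
  measure \<open>d\<theta>\<close> in the polar coordinates formula \<open>dx = r ^ (n - 1) dr d\<theta>\<close>.\<close>

definition sphere_measure :: "(real ^ 'n) measure" where
  "sphere_measure =
    scale_measure (of_nat CARD('n))
      (distr (restrict_space lborel (ball 0 1 - {0})) (restrict_space borel (sphere 0 1)) sgn)"

definition sphere_inner :: "(real ^ 'n \<Rightarrow> real) \<Rightarrow> (real ^ 'n \<Rightarrow> real) \<Rightarrow> real" where
  "sphere_inner u v =
    1 / measure (sphere_measure :: (real ^ 'n) measure) (sphere 0 1) *
      (LINT \<theta>|sphere_measure. u \<theta> * v \<theta>)"

definition spherical_harmonic_basis :: "(nat \<Rightarrow> nat \<Rightarrow> real ^ 'n \<Rightarrow> real) \<Rightarrow> bool" where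
  "spherical_harmonic_basis Y \<longleftrightarrow>
    (\<forall>k. let L = {1..harmonic_dim TYPE('n) k} in
      inj_on (Y k) L \<and>
      fun_space.independent (Y k ` L) \<and>
      fun_space.span (Y k ` L) = harmonic_homogeneous k \<and>
      (\<forall>l\<in>L. \<forall>m\<in>L. sphere_inner (Y k l) (Y k m) = (if l = m then 1 else 0)))"

text \<open>The coefficients of \<open>u(\<theta>) = \<Sum>k. \<Sum>l. u\<^sub>k\<^sub>l Y\<^sub>k\<^sub>l(\<theta>)\<close>.\<close>

definition spherical_coeff ::
    "(nat \<Rightarrow> nat \<Rightarrow> real ^ 'n \<Rightarrow> real) \<Rightarrow> (real ^ 'n \<Rightarrow> real) \<Rightarrow> nat \<Rightarrow> nat \<Rightarrow> real" where
  "spherical_coeff Y u k l = sphere_inner u (Y k l)"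

text \<open>The partial sum over \<open>k < m\<close> of \<open>\<Sum>k. \<Sum>l. h\<^sub>k\<^sub>l(r\<^sup>2) r\<^sup>k Y\<^sub>k\<^sub>l(\<theta>)\<close>, where \<open>r = norm x\<close> and
  \<open>\<theta> = sgn x = x / norm x\<close>.\<close>

definition polyharmonic_partial_sum ::
    "(nat \<Rightarrow> nat \<Rightarrow> real ^ 'n \<Rightarrow> real) \<Rightarrow> (nat \<Rightarrow> nat \<Rightarrow> real poly) \<Rightarrow> nat \<Rightarrow> real ^ 'n \<Rightarrow> real" where
  "polyharmonic_partial_sum Y h m x =
    (\<Sum>k<m. \<Sum>l=1..harmonic_dim TYPE('n) k.
      poly (h k l) ((norm x)\<^sup>2) * norm x ^ k * Y k l (sgn x))"

definition L2_on :: "'a::euclidean_space set \<Rightarrow> ('a \<Rightarrow> real) set" where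
  "L2_on S = {f. set_borel_measurable lebesgue S f \<and> set_integrable lebesgue S (\<lambda>x. (f x)\<^sup>2)}"

definition L2_convergent_on :: "'a::euclidean_space set \<Rightarrow> (nat \<Rightarrow> 'a \<Rightarrow> real) \<Rightarrow> bool" where
  "L2_convergent_on S s \<longleftrightarrow>
    (\<forall>m. s m \<in> L2_on S) \<and>
    (\<exists>g\<in>L2_on S. (\<lambda>m. LINT x:S|lebesgue. (s m x - g x)\<^sup>2) \<longlonglongrightarrow> 0)"

lemma emeasure_sphere_measure:
  fixes A :: "(real ^ 'n) set"
  assumes "A \<in> sets borel" "A \<subseteq> sphere 0 1"
  shows "emeasure sphere_measure A =
    of_nat CARD('n) * emeasure lborel {x \<in> ball 0 1 - {0}. sgn x \<in> A}"
proof -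
  let ?B = "ball 0 1 - {0} :: (real ^ 'n) set"
  have m: "sgn \<in> measurable (restrict_space lborel ?B) (restrict_space borel (sphere 0 1))"
    by (rule measurable_restrict_space3) (auto simp: norm_sgn)
  have A: "A \<in> sets (restrict_space borel (sphere 0 1))"
    using assms by (auto simp: sets_restrict_space_iff)
  have "emeasure (distr (restrict_space lborel ?B) (restrict_space borel (sphere 0 1)) sgn) A =
      emeasure (restrict_space lborel ?B) (sgn -` A \<inter> space (restrict_space lborel ?B))"
    by (rule emeasure_distr[OF m A])
  also have "\<dots> = emeasure lborel (sgn -` A \<inter> space (restrict_space lborel ?B))"
    by (subst emeasure_restrict_space) (auto simp: space_restrict_space)
  also have "sgn -` A \<inter> space (restrict_space lborel ?B) = {x \<in> ?B. sgn x \<in> A}"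
    by (auto simp: space_restrict_space)
  finally show ?thesis
    by (simp add: sphere_measure_def)
qed

text \<open>The interpolation conditions at the radii \<open>r j\<close> determine a unique polynomial.\<close>

lemma radial_interpolation_ex1:
  fixes r \<phi> :: "nat \<Rightarrow> real"
  assumes "N \<ge> 1" "\<forall>j\<in>{1..N}. 0 < r j" "inj_on r {1..N}"
  shows "\<exists>!p. degree p \<le> N - 1 \<and> (\<forall>j\<in>{1..N}. r j ^ k * poly p ((r j)\<^sup>2) = \<phi> j)"
proof -
  define a where "a = (\<lambda>j. (r j)\<^sup>2)"
  define b where "b = (\<lambda>j. \<phi> j / r j ^ k)"
  have inj: "inj_on a {1..N}"
  proof (rule inj_onI)
    fix i j assume ij: "i \<in> {1..N}" "j \<in> {1..N}" "a i = a j"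
    have "0 \<le> r i" "0 \<le> r j" using assms(2) ij(1,2) by (auto intro: less_imp_le)
    with ij(3) have "r i = r j" unfolding a_def by (metis power2_eq_imp_eq)
    with ij assms(3) show "i = j" by (auto dest: inj_onD)
  qed
  have iff: "(r j ^ k * poly p ((r j)\<^sup>2) = \<phi> j) = (poly p (a j) = b j)" if "j \<in> {1..N}" for j p
  proof -
    have "r j ^ k \<noteq> 0" using assms(2) that by force
    then show ?thesis by (auto simp: a_def b_def field_simps)
  qed
  define P where "P = (\<lambda>i. \<Prod>j\<in>{1..N}-{i}. smult (1 / (a i - a j)) [:- a j, 1:])"
  have deg: "degree (P i) \<le> N - 1" if "i \<in> {1..N}" for i
  proof -
    have "degree (P i) \<le> (\<Sum>j\<in>{1..N}-{i}. degree (smult (1 / (a i - a j)) [:- a j, 1:]))"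
      unfolding P_def by (rule degree_prod_sum_le[unfolded o_def]) simp
    also have "\<dots> \<le> (\<Sum>j\<in>{1..N}-{i}. 1)"
      by (rule sum_mono) auto
    also have "\<dots> = N - 1" using that by simp
    finally show ?thesis .
  qed
  have val: "poly (P i) (a j) = (if i = j then 1 else 0)" if "i \<in> {1..N}" "j \<in> {1..N}" for i j
  proof (cases "i = j")
    case True
    have "poly (smult (1 / (a i - a m)) [:- a m, 1:]) (a i) = 1" if "m \<in> {1..N} - {i}" for m
    proof -
      have "a i \<noteq> a m" using inj that \<open>i \<in> {1..N}\<close> by (auto dest: inj_onD)
      then have "1 / (a i - a m) * (a i - a m) = 1" by simp
      then show ?thesis by (simp only: poly_smult poly_pCons poly_0) simp
    qed
    then have "poly (P i) (a i) = 1"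
      unfolding P_def poly_prod by (intro prod.neutral) blast
    then show ?thesis using True by simp
  next
    case False
    have "poly (smult (1 / (a i - a j)) [:- a j, 1:]) (a j) = 0" by simp
    then have "poly (P i) (a j) = 0"
      unfolding P_def poly_prod using False that by (intro prod_zero) blast+
    then show ?thesis using False by simp
  qed
  define Q where "Q = (\<Sum>i\<in>{1..N}. smult (b i) (P i))"
  have Qd: "degree Q \<le> N - 1"
    unfolding Q_def
  proof (rule degree_sum_le)
    fix i assume "i \<in> {1..N}"
    then show "degree (smult (b i) (P i)) \<le> N - 1"
      using deg[of i] degree_smult_le[of "b i" "P i"] by linarith
  qed simp
  have Qv: "poly Q (a j) = b j" if "j \<in> {1..N}" for j
  proof -
    have "poly Q (a j) = (\<Sum>i\<in>{1..N}. if i = j then b i else 0)"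
      unfolding Q_def poly_sum by (rule sum.cong) (use val that in auto)
    then show ?thesis using that by simp
  qed
  show ?thesis
  proof (rule ex1I[of _ Q])
    show "degree Q \<le> N - 1 \<and> (\<forall>j\<in>{1..N}. r j ^ k * poly Q ((r j)\<^sup>2) = \<phi> j)"
      using Qd Qv iff by blast
  next
    fix p assume p: "degree p \<le> N - 1 \<and> (\<forall>j\<in>{1..N}. r j ^ k * poly p ((r j)\<^sup>2) = \<phi> j)"
    show "p = Q"
    proof (rule ccontr)
      assume "p \<noteq> Q"
      then have nz: "p - Q \<noteq> 0" by simp
      have "a ` {1..N} \<subseteq> {x. poly (p - Q) x = 0}"
        using p Qv iff by fastforce
      then have "card (a ` {1..N}) \<le> degree (p - Q)"
        by (rule card_mono[OF poly_roots_finite[OF nz], THEN le_trans[OF _ card_poly_roots_bound[OF nz]]])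
      moreover have "card (a ` {1..N}) = N" using card_image[OF inj] by simp
      moreover have "degree (p - Q) \<le> N - 1" using p Qd by (intro degree_diff_le) auto
      ultimately show False using assms(1) by linarith
    qed
  qed
qed

end

theory Submission imports Defs begin

text \<open>
  Put \<open>M = max\<^sub>j exp (- \<eta>\<^sub>j) / r\<^sub>j\<close> and \<open>q = R M < 1\<close>. The interpolation conditions bound
  \<open>h\<^sub>k\<^sub>l\<close> at the fixed nodes \<open>r\<^sub>j\<^sup>2\<close> by \<open>K M\<^sup>k\<close>, hence, since the degree is less than the number of nodes,
  by a constant multiple of \<open>M\<^sup>k\<close> on all of \<open>[0, R\<^sup>2]\<close>; so \<open>\<bar>h\<^sub>k\<^sub>l(r\<^sup>2) r\<^sup>k\<bar>\<close> is at most a constant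
  multiple of \<open>q\<^sup>k\<close> for \<open>r < R\<close>. The normalisation of \<open>Y\<^sub>k\<^sub>l\<close> makes the integral of \<open>Y\<^sub>k\<^sub>l(\<theta>)\<^sup>2\<close> over
  the ball independent of \<open>k\<close> and \<open>l\<close>, and \<open>d\<^sub>k \<le> (k + 1)\<^sup>n\<close> by counting monomials, so the squared
  \<open>L\<^sub>2\<close> norm of the \<open>k\<close>-th block is \<open>O(k\<^sup>2\<^sup>n q\<^sup>2\<^sup>k)\<close>. For such geometrically decaying blocks \<open>v\<^sub>k\<close> the
  pointwise sum is an \<open>L\<^sub>2\<close> limit: by Cauchy--Schwarz the tail from \<open>m\<close> on satisfies
  \<open>(\<Sum>\<^sub>k\<^sub>\<ge>\<^sub>m v\<^sub>k)\<^sup>2 \<le> q\<^sup>m / (1 - q) \<cdot> \<Sum>\<^sub>k v\<^sub>k\<^sup>2 / q\<^sup>k\<close>, whose last factor is integrable.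
\<close>

section \<open>Bounding a polynomial by its values at fixed nodes\<close>

text \<open>Induction on the nodes by Newton's scheme: splitting off a node \<open>a\<close> writes
  \<open>p\<close> as \<open>poly p a\<close> plus \<open>x - a\<close> times a quotient of smaller
  degree, whose values at the other nodes are divided differences of \<open>p\<close>. The disjunct
  \<open>p = 0\<close> covers the empty node set and a vanishing quotient, where no degree lies
  below the number of nodes.\<close>

lemma poly_bounded_by_node_values:
  fixes A :: "real set"
  assumes "finite A"
  obtains C where "C \<ge> 0"
    and "\<And>p B t. p = 0 \<or> degree p < card A \<Longrightarrow> B \<ge> 0 \<Longrightarrow> (\<And>a. a \<in> A \<Longrightarrow> \<bar>poly p a\<bar> \<le> B)
      \<Longrightarrow> \<bar>t\<bar> \<le> T \<Longrightarrow> \<bar>poly p t\<bar> \<le> C * B"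
proof -
  have "\<exists>C\<ge>0. \<forall>p B t. (p = 0 \<or> degree p < card A) \<longrightarrow> B \<ge> 0 \<longrightarrow> (\<forall>a\<in>A. \<bar>poly p a\<bar> \<le> B)
      \<longrightarrow> \<bar>t\<bar> \<le> T \<longrightarrow> \<bar>poly p t\<bar> \<le> C * B"
    using assms
  proof (induction A)
    case empty
    then show ?case by (intro exI[of _ 0]) auto
  next
    case (insert a A)
    then obtain C where "C \<ge> 0" and C: "\<And>p B t. p = 0 \<or> degree p < card A \<Longrightarrow> B \<ge> 0 \<Longrightarrow>
        \<forall>a\<in>A. \<bar>poly p a\<bar> \<le> B \<Longrightarrow> \<bar>t\<bar> \<le> T \<Longrightarrow> \<bar>poly p t\<bar> \<le> C * B"
      by blast
    \<comment> \<open>Each divided difference \<open>(poly p b - poly p a) / (b - a)\<close> is at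
      most \<open>2 * B / \<bar>b - a\<bar>\<close>; the sum dominates all of these factors at
      once.\<close>
    define D where "D = (\<Sum>b\<in>A. 2 / \<bar>b - a\<bar>)"
    have D: "D \<ge> 0" unfolding D_def by (intro sum_nonneg) simp
    \<comment> \<open>The summand 1 accounts for \<open>poly p a\<close>, the rest for
      \<open>t - a\<close> times the quotient. Writing \<open>\<bar>T\<bar>\<close> keeps the
      constant nonnegative whatever the sign of \<open>T\<close>.\<close>
    have "\<bar>poly p t\<bar> \<le> (1 + (\<bar>T\<bar> + \<bar>a\<bar>) * (C * D)) * B"
      if p: "p = 0 \<or> degree p < card (insert a A)" and B: "B \<ge> 0"
        and val: "\<forall>b\<in>insert a A. \<bar>poly p b\<bar> \<le> B" and t: "\<bar>t\<bar> \<le> T" for p B t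
    proof -
      have "[:-a, 1:] dvd p - [:poly p a:]"
        by (simp add: poly_eq_0_iff_dvd[symmetric])
      then obtain q where q: "p - [:poly p a:] = [:-a, 1:] * q" by (rule dvdE)
      have pe: "poly p x = poly p a + (x - a) * poly q x" for x
        using arg_cong[OF q, of "\<lambda>p. poly p x"] by (simp add: algebra_simps)
      have dq: "q = 0 \<or> degree q < card A"
      proof (cases "q = 0")
        case False
        then have "degree ([:-a, 1:] * q) = Suc (degree q)"
          by (subst degree_mult_eq) auto
        moreover have "degree (p - [:poly p a:]) \<le> degree p"
          by (rule degree_diff_le) auto
        ultimately have "Suc (degree q) \<le> degree p" using q by simp
        with p insert.hyps show ?thesis by auto
      qed simp
      have qb: "\<bar>poly q b\<bar> \<le> D * B" if "b \<in> A" for b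
      proof -
        have "b \<noteq> a" using that insert.hyps by auto
        then have "poly q b = (poly p b - poly p a) / (b - a)"
          by (subst pe[of b]) simp
        then have "\<bar>poly q b\<bar> = \<bar>poly p b - poly p a\<bar> / \<bar>b - a\<bar>" by simp
        also have "\<dots> \<le> (2 * B) / \<bar>b - a\<bar>"
        proof (rule divide_right_mono)
          have "\<bar>poly p b\<bar> \<le> B" "\<bar>poly p a\<bar> \<le> B" using val that by auto
          then show "\<bar>poly p b - poly p a\<bar> \<le> 2 * B" by linarith
        qed simp
        also have "\<dots> = (2 / \<bar>b - a\<bar>) * B" by simp
        also have "\<dots> \<le> D * B"
          unfolding D_def using that insert.hyps B
          by (intro mult_right_mono member_le_sum) auto
        finally show ?thesis .
      qed
      have "\<bar>poly q t\<bar> \<le> C * (D * B)"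
        by (rule C[OF dq]) (use qb t D B in auto)
      moreover have "\<bar>t - a\<bar> \<le> \<bar>T\<bar> + \<bar>a\<bar>" using t by linarith
      ultimately have "\<bar>t - a\<bar> * \<bar>poly q t\<bar> \<le> (\<bar>T\<bar> + \<bar>a\<bar>) * (C * (D * B))"
        by (intro mult_mono) auto
      moreover have "\<bar>poly p t\<bar> \<le> \<bar>poly p a\<bar> + \<bar>t - a\<bar> * \<bar>poly q t\<bar>"
        by (subst pe[of t]) (use abs_triangle_ineq abs_mult in metis)
      moreover have "\<bar>poly p a\<bar> \<le> B" using val by simp
      ultimately show ?thesis by (simp add: algebra_simps)
    qed
    then show ?case
      using \<open>C \<ge> 0\<close> D
      by (intro exI[of _ "1 + (\<bar>T\<bar> + \<bar>a\<bar>) * (C * D)"] conjI allI impI) (simp, blast)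
  qed
  then obtain C where "C \<ge> 0" and C: "\<forall>p B t. (p = 0 \<or> degree p < card A) \<longrightarrow> B \<ge> 0 \<longrightarrow>
      (\<forall>a\<in>A. \<bar>poly p a\<bar> \<le> B) \<longrightarrow> \<bar>t\<bar> \<le> T \<longrightarrow> \<bar>poly p t\<bar> \<le> C * B"
    by (elim exE conjE)
  show thesis
    by (rule that[OF \<open>C \<ge> 0\<close>]) (rule C[rule_format])
qed

section \<open>Square-integrable series with geometric weights\<close>

text \<open>Summability follows from the arithmetic-geometric mean inequality, which dominates
  \<open>\<bar>a k\<bar>\<close> by \<open>q ^ k\<close> plus the weighted square. For the tail,
  finite sections are bounded uniformly in their upper end \<open>n\<close>, and then
  \<open>n\<close> tends to infinity.\<close>

lemma weighted_square_summable:
  fixes a :: "nat \<Rightarrow> real"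
  assumes q: "0 < q" "q < 1" and sm: "summable (\<lambda>k. (a k)\<^sup>2 / q ^ k)"
  shows "summable a"
    and "((\<Sum>k<m. a k) - suminf a)\<^sup>2 \<le> q ^ m / (1 - q) * (\<Sum>k. (a k)\<^sup>2 / q ^ k)"
proof -
  show sa: "summable a"
  proof (rule summable_comparison_test')
    show "summable (\<lambda>k. q ^ k + (a k)\<^sup>2 / q ^ k)"
      using q sm by (intro summable_add summable_geometric) auto
    show "norm (a k) \<le> q ^ k + (a k)\<^sup>2 / q ^ k" if "k \<ge> 0" for k
    proof -
      have Q: "q ^ k > 0" using q by simp
      have "2 * (q ^ k * \<bar>a k\<bar>) \<le> (q ^ k)\<^sup>2 + (a k)\<^sup>2"
        using sum_squares_bound[of "q ^ k" "\<bar>a k\<bar>"] by simp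
      moreover have "0 \<le> q ^ k * \<bar>a k\<bar>" using Q by simp
      ultimately have "\<bar>a k\<bar> * q ^ k \<le> (q ^ k)\<^sup>2 + (a k)\<^sup>2" by (simp add: mult.commute)
      then have "\<bar>a k\<bar> \<le> ((q ^ k)\<^sup>2 + (a k)\<^sup>2) / q ^ k" using Q by (simp add: pos_le_divide_eq)
      then show ?thesis using Q by (simp add: add_divide_distrib power2_eq_square split: if_splits)
    qed
  qed
  have bound: "((\<Sum>k<m. a k) - (\<Sum>k<n. a k))\<^sup>2 \<le> q ^ m / (1 - q) * (\<Sum>k. (a k)\<^sup>2 / q ^ k)"
    if "n \<ge> m" for n
  proof -
    have "((\<Sum>k<m. a k) - (\<Sum>k<n. a k))\<^sup>2 = (\<Sum>k=m..<n. a k)\<^sup>2"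
      using sum_diff_nat_ivl[of 0 m n a] that
      by (metis atLeast0LessThan power2_commute zero_le)
    \<comment> \<open>Splitting off \<open>sqrt (q ^ k)\<close> lets Cauchy-Schwarz separate a
      geometric tail, of order \<open>q ^ m\<close>, from the weighted squares.\<close>
    also have "\<dots> = (\<Sum>k=m..<n. sqrt (q ^ k) * (a k / sqrt (q ^ k)))\<^sup>2"
      using q by (intro arg_cong[where f = "\<lambda>x. x\<^sup>2"] sum.cong) auto
    also have "\<dots> \<le> (\<Sum>k=m..<n. (sqrt (q ^ k))\<^sup>2) * (\<Sum>k=m..<n. (a k / sqrt (q ^ k))\<^sup>2)"
      by (rule Cauchy_Schwarz_ineq_sum)
    also have "\<dots> = (\<Sum>k=m..<n. q ^ k) * (\<Sum>k=m..<n. (a k)\<^sup>2 / q ^ k)"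
      using q by (simp add: power_divide)
    also have "\<dots> \<le> q ^ m / (1 - q) * (\<Sum>k. (a k)\<^sup>2 / q ^ k)"
    proof (rule mult_mono)
      have "(1 - q) * (\<Sum>k=m..<n. q ^ k) = q ^ m - q ^ n"
        using that
      proof (induction n rule: dec_induct)
        case (step n)
        then have "(1 - q) * (\<Sum>k=m..<Suc n. q ^ k) = (q ^ m - q ^ n) + (1 - q) * q ^ n"
          by (simp add: distrib_left)
        then show ?case by (simp add: algebra_simps)
      qed simp
      then have "(\<Sum>k=m..<n. q ^ k) = (q ^ m - q ^ n) / (1 - q)"
        using q by (simp add: field_simps)
      also have "\<dots> \<le> q ^ m / (1 - q)"
        using q by (intro divide_right_mono) auto
      finally show "(\<Sum>k=m..<n. q ^ k) \<le> q ^ m / (1 - q)" .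
      show "(\<Sum>k=m..<n. (a k)\<^sup>2 / q ^ k) \<le> (\<Sum>k. (a k)\<^sup>2 / q ^ k)"
        using q by (intro sum_le_suminf sm) auto
    qed (use q in \<open>auto intro!: sum_nonneg\<close>)
    finally show ?thesis .
  qed
  have "(\<lambda>n. ((\<Sum>k<m. a k) - (\<Sum>k<n. a k))\<^sup>2) \<longlonglongrightarrow> ((\<Sum>k<m. a k) - suminf a)\<^sup>2"
    by (intro tendsto_intros summable_LIMSEQ sa)
  then show "((\<Sum>k<m. a k) - suminf a)\<^sup>2 \<le> q ^ m / (1 - q) * (\<Sum>k. (a k)\<^sup>2 / q ^ k)"
    by (rule LIMSEQ_le_const2) (use bound in blast)
qed

text \<open>Sum and integral may be exchanged in the extended nonnegative reals, so the sum has
  finite integral and is therefore finite almost everywhere.\<close>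

lemma AE_summable_of_summable_integrals:
  fixes v :: "nat \<Rightarrow> 'a \<Rightarrow> real"
  assumes int: "\<And>k. integrable M (v k)" and nn: "\<And>k x. 0 \<le> v k x"
    and sm: "summable (\<lambda>k. \<integral>x. v k x \<partial>M)"
  shows "AE x in M. summable (\<lambda>k. v k x)"
proof -
  have [measurable]: "v k \<in> borel_measurable M" for k using int by auto
  have "(\<integral>\<^sup>+ x. (\<Sum>k. ennreal (v k x)) \<partial>M) = (\<Sum>k. ennreal (\<integral>x. v k x \<partial>M))"
    by (simp add: nn_integral_suminf nn_integral_eq_integral[OF int] nn)
  also have "\<dots> \<noteq> \<infinity>"
    unfolding infinity_ennreal_def
    by (rule ennreal_suminf_neq_top[OF sm]) (intro integral_nonneg_AE AE_I2 nn)
  finally have "AE x in M. (\<Sum>k. ennreal (v k x)) \<noteq> \<infinity>"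
    by (intro nn_integral_PInf_AE) auto
  then show ?thesis
  proof eventually_elim
    case (elim x)
    then show ?case using nn by (intro summable_suminf_not_top) auto
  qed
qed

lemma L2_series_convergent:
  fixes u :: "nat \<Rightarrow> 'a \<Rightarrow> real"
  assumes q: "0 < q" "q < 1"
    and meas [measurable]: "\<And>k. u k \<in> borel_measurable M"
    and int: "\<And>k. integrable M (\<lambda>x. (u k x)\<^sup>2)"
    and sm: "summable (\<lambda>k. (\<integral>x. (u k x)\<^sup>2 \<partial>M) / q ^ k)"
  obtains g where "g \<in> borel_measurable M" "integrable M (\<lambda>x. (g x)\<^sup>2)"
    "(\<lambda>m. \<integral>x. ((\<Sum>k<m. u k x) - g x)\<^sup>2 \<partial>M) \<longlonglongrightarrow> 0"
    "\<And>m. integrable M (\<lambda>x. ((\<Sum>k<m. u k x) - g x)\<^sup>2)"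
proof -
  define v where "v = (\<lambda>k x. (u k x)\<^sup>2 / q ^ k)"
  define G where "G = (\<lambda>x. \<Sum>k. v k x)"
  \<comment> \<open>The limit is the pointwise sum. Where the series diverges \<open>suminf\<close>
    is an arbitrary value, but the weighted squares are summable almost everywhere, so those points
    form a null set.\<close>
  define g where "g = (\<lambda>x. \<Sum>k. u k x)"
  have vint: "integrable M (v k)" for k unfolding v_def using int by simp
  have v0: "0 \<le> v k x" for k x unfolding v_def using q by simp
  have vsm: "summable (\<lambda>k. \<integral>x. v k x \<partial>M)" using sm by (simp add: v_def)
  have ae: "AE x in M. summable (\<lambda>k. v k x)"
    by (rule AE_summable_of_summable_integrals[OF vint v0 vsm])
  have Gint: "integrable M G"
    unfolding G_def by (rule integrable_suminf[OF vint]) (use ae vsm v0 in simp_all)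
  have [measurable]: "g \<in> borel_measurable M" unfolding g_def by measurable
  have le: "AE x in M. norm (((\<Sum>k<m. u k x) - g x)\<^sup>2) \<le> q ^ m / (1 - q) * G x" for m
    using ae unfolding g_def G_def v_def
    by eventually_elim (use weighted_square_summable(2)[OF q] in simp)
  have dint: "integrable M (\<lambda>x. ((\<Sum>k<m. u k x) - g x)\<^sup>2)" for m
  proof (rule Bochner_Integration.integrable_bound)
    show "integrable M (\<lambda>x. q ^ m / (1 - q) * G x)" using Gint by simp
    show "AE x in M. norm (((\<Sum>k<m. u k x) - g x)\<^sup>2) \<le> norm (q ^ m / (1 - q) * G x)"
      using le[of m] by eventually_elim (metis abs_ge_self order_trans real_norm_def)
  qed measurable
  have "(\<lambda>m. \<integral>x. ((\<Sum>k<m. u k x) - g x)\<^sup>2 \<partial>M) \<longlonglongrightarrow> 0"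
  proof (rule tendsto_sandwich)
    show "\<forall>\<^sub>F m in sequentially. 0 \<le> (\<integral>x. ((\<Sum>k<m. u k x) - g x)\<^sup>2 \<partial>M)" by simp
    show "\<forall>\<^sub>F m in sequentially.
        (\<integral>x. ((\<Sum>k<m. u k x) - g x)\<^sup>2 \<partial>M) \<le> q ^ m / (1 - q) * (\<integral>x. G x \<partial>M)"
    proof (intro always_eventually allI)
      fix m
      have "(\<integral>x. ((\<Sum>k<m. u k x) - g x)\<^sup>2 \<partial>M) \<le> (\<integral>x. q ^ m / (1 - q) * G x \<partial>M)"
        by (rule integral_mono_AE) (use dint Gint le[of m] in auto)
      then show "(\<integral>x. ((\<Sum>k<m. u k x) - g x)\<^sup>2 \<partial>M) \<le> q ^ m / (1 - q) * (\<integral>x. G x \<partial>M)"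
        by simp
    qed
    have "(\<lambda>m. q ^ m / (1 - q) * (\<integral>x. G x \<partial>M)) \<longlonglongrightarrow> 0 / (1 - q) * (\<integral>x. G x \<partial>M)"
      using q by (intro tendsto_intros LIMSEQ_power_zero) auto
    then show "(\<lambda>m. q ^ m / (1 - q) * (\<integral>x. G x \<partial>M)) \<longlonglongrightarrow> 0" by simp
  qed simp
  \<comment> \<open>For \<open>m = 0\<close> the partial sum is empty and the error is
    \<open>g\<close> itself up to sign.\<close>
  moreover have "integrable M (\<lambda>x. (g x)\<^sup>2)" using dint[of 0] by simp
  ultimately show thesis by (intro that[of g] dint) simp_all
qed

section \<open>From integrals over the sphere to integrals over balls\<close>

text \<open>The sphere measure is a scaled push-forward under \<open>sgn\<close> from the punctured
  ball; putting the origin back adds only a null set.\<close>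

lemma nn_integral_sphere_measure:
  fixes g :: "real ^ 'n \<Rightarrow> ennreal"
  assumes [measurable]: "g \<in> borel_measurable borel"
  shows "(\<integral>\<^sup>+\<theta>. g \<theta> \<partial>sphere_measure) =
    of_nat CARD('n) * (\<integral>\<^sup>+x. g (sgn x) * indicator (ball 0 1) x \<partial>lborel)"
proof -
  let ?B = "ball 0 1 - {0} :: (real ^ 'n) set"
  have m: "sgn \<in> measurable (restrict_space lborel ?B) (restrict_space borel (sphere 0 1))"
    by (rule measurable_restrict_space3) (auto simp: norm_sgn)
  have g: "g \<in> borel_measurable (restrict_space borel (sphere 0 1))"
    by (rule measurable_restrict_space1) simp
  have "(\<integral>\<^sup>+\<theta>. g \<theta> \<partial>sphere_measure) =
      of_nat CARD('n) * (\<integral>\<^sup>+x. g (sgn x) \<partial>restrict_space lborel ?B)"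
    unfolding sphere_measure_def
    by (simp add: nn_integral_scale_measure nn_integral_distr[OF m] g)
  also have "(\<integral>\<^sup>+x. g (sgn x) \<partial>restrict_space lborel ?B) =
      (\<integral>\<^sup>+x. g (sgn x) * indicator ?B x \<partial>lborel)"
    by (rule nn_integral_restrict_space) simp
  also have "\<dots> = (\<integral>\<^sup>+x. g (sgn x) * indicator (ball 0 1) x \<partial>lborel)"
    by (rule nn_integral_cong_AE, rule AE_mp[OF AE_lborel_singleton[of 0]])
      (auto simp: indicator_def)
  finally show ?thesis .
qed

text \<open>The dilation by \<open>R\<close> has Jacobian \<open>R ^ DIM('a)\<close> and leaves
  \<open>sgn\<close> unchanged.\<close>

lemma nn_integral_sgn_ball:
  fixes g :: "'a::euclidean_space \<Rightarrow> ennreal"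
  assumes [measurable]: "g \<in> borel_measurable borel" and R: "R > 0"
  shows "(\<integral>\<^sup>+x. g (sgn x) * indicator (ball 0 R) x \<partial>lborel) =
    ennreal (R ^ DIM('a)) * (\<integral>\<^sup>+x. g (sgn x) * indicator (ball 0 1) x \<partial>lborel)"
proof -
  have [measurable]: "(\<lambda>x::'a. g (sgn x)) \<in> borel_measurable borel"
    by (rule measurable_compose[OF borel_measurable_sgn assms(1)])
  have [measurable]: "ball (0::'a) R \<in> sets borel" by simp
  have "(\<integral>\<^sup>+x. g (sgn x) * indicator (ball 0 R) x \<partial>lborel) =
      (\<integral>\<^sup>+x. g (sgn x) * indicator (ball 0 R) x
        \<partial>density (distr lborel borel (\<lambda>x. 0 + R *\<^sub>R x)) (\<lambda>_. ennreal (\<bar>R\<bar> ^ DIM('a))))"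
    using R by (subst lborel_affine[of R "0::'a"]) auto
  also have "\<dots> = ennreal (R ^ DIM('a)) * (\<integral>\<^sup>+x. g (sgn (R *\<^sub>R x)) * indicator (ball 0 R) (R *\<^sub>R x) \<partial>lborel)"
    using R by (subst nn_integral_density, measurable)
      (subst nn_integral_distr, measurable, simp add: nn_integral_cmult del: sgn_scaleR)
  also have "(\<lambda>x::'a. g (sgn (R *\<^sub>R x)) * indicator (ball 0 R) (R *\<^sub>R x)) =
      (\<lambda>x. g (sgn x) * indicator (ball 0 1) x)"
    using R by (auto simp: fun_eq_iff indicator_def sgn_scaleR)
  finally show ?thesis .
qed

text \<open>This is integration in polar coordinates of a function constant along rays. The constant
  \<open>V\<close> is the volume of the ball of radius \<open>R\<close>, so it is the same for every
  normalised \<open>p\<close>.\<close>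

lemma sphere_inner_one_integral_ball:
  fixes p :: "real ^ 'n \<Rightarrow> real"
  assumes p [measurable]: "p \<in> borel_measurable borel" and one: "sphere_inner p p = 1" and R: "R > 0"
  defines "V \<equiv> R ^ CARD('n) * measure (sphere_measure :: (real ^ 'n) measure) (sphere 0 1) / CARD('n)"
  shows "integrable lborel (\<lambda>x. (p (sgn x))\<^sup>2 * indicator (ball 0 R) x)"
    and "(\<integral>x. (p (sgn x))\<^sup>2 * indicator (ball 0 R) x \<partial>lborel) = V"
proof -
  let ?S = "sphere_measure :: (real ^ 'n) measure"
  let ?a = "measure ?S (sphere 0 1)"
  have [measurable]: "(\<lambda>x::real^'n. p (sgn x)) \<in> borel_measurable borel"
    by (rule measurable_compose[OF borel_measurable_sgn p])
  have [measurable]: "ball (0::real^'n) R \<in> sets borel" by simp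
  have "(LINT \<theta>|?S. p \<theta> * p \<theta>) / ?a = 1"
    using one by (simp add: sphere_inner_def)
  \<comment> \<open>Integrability is extracted from default values: division by zero gives 0 rather
    than 1, so \<open>?a\<close> is nonzero, and a non-integrable function would have integral 0
    rather than \<open>?a\<close>.\<close>
  then have a: "(LINT \<theta>|?S. (p \<theta>)\<^sup>2) = ?a" "?a \<noteq> 0"
    by (auto simp: field_simps power2_eq_square)
  then have "integrable ?S (\<lambda>\<theta>. (p \<theta>)\<^sup>2)"
    using not_integrable_integral_eq by metis
  then have "(\<integral>\<^sup>+\<theta>. ennreal ((p \<theta>)\<^sup>2) \<partial>?S) = ennreal ?a"
    using a by (simp add: nn_integral_eq_integral)
  then have n: "of_nat CARD('n) * (\<integral>\<^sup>+x. ennreal ((p (sgn x))\<^sup>2) * indicator (ball 0 1) x \<partial>lborel) = ennreal ?a"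
    using nn_integral_sphere_measure[of "\<lambda>x. ennreal ((p x)\<^sup>2)"] by simp
  have "of_nat CARD('n) * (\<integral>\<^sup>+x. ennreal ((p (sgn x))\<^sup>2) * indicator (ball 0 R) x \<partial>lborel)
      = ennreal (R ^ CARD('n)) * ennreal ?a"
    using nn_integral_sgn_ball[of "\<lambda>x::real^'n. ennreal ((p x)\<^sup>2)", OF _ R]
    by (simp add: n[symmetric] mult.left_commute)
  also have "\<dots> = of_nat CARD('n) * ennreal V"
    using R by (simp add: V_def ennreal_mult[symmetric] ennreal_of_nat_eq_real_of_nat)
  finally have nn: "(\<integral>\<^sup>+x. ennreal ((p (sgn x))\<^sup>2) * indicator (ball 0 R) x \<partial>lborel) = ennreal V"
    by (subst (asm) ennreal_mult_cancel_left) auto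
  have V: "V \<ge> 0" using R by (simp add: V_def)
  have nn': "(\<integral>\<^sup>+x. ennreal ((p (sgn x))\<^sup>2 * indicator (ball 0 R) x) \<partial>lborel) = ennreal V"
    unfolding nn[symmetric] by (intro nn_integral_cong) (auto simp: indicator_def)
  show "integrable lborel (\<lambda>x. (p (sgn x))\<^sup>2 * indicator (ball 0 R) x)"
    by (rule integrableI_nonneg) (auto simp: nn')
  show "(\<integral>x. (p (sgn x))\<^sup>2 * indicator (ball 0 R) x \<partial>lborel) = V"
    by (rule integral_eq_nn_integral[THEN trans]) (auto simp: nn' V)
qed

section \<open>Polynomial growth of the dimensions of spherical harmonics\<close>

lemma sum_fun_apply: "(\<Sum>i\<in>A. f i) x = (\<Sum>i\<in>A. f i x)"
  by (induction A rule: infinite_finite_induct) auto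

definition monomial :: "('n::finite \<Rightarrow> nat) \<Rightarrow> real ^ 'n \<Rightarrow> real" where
  "monomial \<alpha> x = (\<Prod>i\<in>UNIV. (x $ i) ^ \<alpha> i)"

lemma monomial_mult: "monomial \<alpha> x * monomial \<beta> x = monomial (\<lambda>i. \<alpha> i + \<beta> i) x"
  by (simp add: monomial_def power_add prod.distrib)

lemma monomial_scaleR: "monomial \<alpha> (c *\<^sub>R x) = c ^ (\<Sum>i\<in>UNIV. \<alpha> i) * monomial \<alpha> x"
  by (simp add: monomial_def power_mult_distrib prod.distrib power_sum)

text \<open>Bilinearity, through one span induction for each factor, reduces the claim to a product
  of two monomials. It supplies the product case for general polynomial functions.\<close>

lemma span_range_monomial_mult:
  fixes p q :: "real ^ 'n \<Rightarrow> real"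
  assumes "p \<in> fun_space.span (range monomial)" "q \<in> fun_space.span (range monomial)"
  shows "(\<lambda>x. p x * q x) \<in> fun_space.span (range monomial)"
  using assms(1)
proof (induction rule: fun_space.span_induct_alt)
  case base
  show ?case using fun_space.span_zero by (simp add: zero_fun_def)
next
  case (step c s y)
  then obtain \<alpha> where s: "s = monomial \<alpha>" by blast
  have "(\<lambda>x. s x * q x) \<in> fun_space.span (range monomial)"
    using assms(2)
  proof (induction rule: fun_space.span_induct_alt)
    case base
    show ?case using fun_space.span_zero by (simp add: zero_fun_def)
  next
    case (step d t z)
    then obtain \<beta> where t: "t = monomial \<beta>" by blast
    have "(\<lambda>x. d * monomial (\<lambda>i. \<alpha> i + \<beta> i) x) + (\<lambda>x. s x * z x) \<in> fun_space.span (range monomial)"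
      by (intro fun_space.span_add fun_space.span_scale fun_space.span_base step.IH) auto
    then show ?case
      by (simp add: s t plus_fun_def monomial_mult[symmetric] algebra_simps)
  qed
  then have "(\<lambda>x. c * (s x * q x)) + (\<lambda>x. y x * q x) \<in> fun_space.span (range monomial)"
    by (intro fun_space.span_add fun_space.span_scale step.IH)
  then show ?case by (simp add: plus_fun_def algebra_simps)
qed

text \<open>Structural induction. A linear functional is a combination of coordinates, which are the
  monomials whose exponent is a unit vector.\<close>

lemma real_polynomial_function_in_span_monomial:
  fixes p :: "real ^ 'n \<Rightarrow> real"
  assumes "real_polynomial_function p"
  shows "p \<in> fun_space.span (range monomial)"
  using assms
proof induction
  case (linear f)
  have coord: "monomial (\<lambda>j. if j = i then 1 else 0) = (\<lambda>x::real^'n. x $ i)" for i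
    by (simp add: fun_eq_iff monomial_def if_distrib[of "\<lambda>n. _ ^ n"] cong: if_cong)
  have f: "f x = (\<Sum>i\<in>UNIV. f (axis i 1) * x $ i)" for x
  proof -
    interpret bounded_linear f by fact
    have "f x = f (\<Sum>i\<in>UNIV. x $ i *\<^sub>R axis i 1)"
      using basis_expansion[of x] by (simp add: scalar_mult_eq_scaleR)
    then show ?thesis by (simp add: sum scaleR mult.commute)
  qed
  have "f = (\<Sum>i\<in>UNIV. (\<lambda>x. f (axis i 1) * monomial (\<lambda>j. if j = i then 1 else 0) x))"
    by (rule ext) (simp only: coord sum_fun_apply, rule f)
  moreover have "\<dots> \<in> fun_space.span (range monomial)"
    by (intro fun_space.span_sum fun_space.span_scale fun_space.span_base) auto
  ultimately show ?case by simp
next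
  case (const c)
  have "(\<lambda>x. c * monomial (\<lambda>_. 0) x) \<in> fun_space.span (range (monomial :: _ \<Rightarrow> real ^ 'n \<Rightarrow> real))"
    by (intro fun_space.span_scale fun_space.span_base) auto
  then show ?case by (simp add: monomial_def[of "\<lambda>_. 0"])
next
  case (add f g)
  then show ?case using fun_space.span_add[of f _ g] by (simp add: plus_fun_def)
next
  case (mult f g)
  then show ?case using span_range_monomial_mult by blast
qed

text \<open>In an expansion of \<open>p\<close> into monomials, homogeneity forces the terms of
  total degree other than \<open>k\<close> to cancel, so they can be discarded.\<close>

lemma homogeneous_polynomial_in_span:
  fixes p :: "real ^ 'n \<Rightarrow> real"
  assumes "real_polynomial_function p" and hom: "\<And>c x. p (c *\<^sub>R x) = c ^ k * p x"
  shows "p \<in> fun_space.span (monomial ` {\<alpha>. (\<Sum>i\<in>UNIV. \<alpha> i) = k})"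
proof -
  obtain t a where t: "finite t" "t \<subseteq> range monomial" and p: "p = (\<Sum>m\<in>t. (\<lambda>x. a m * m x))"
    using real_polynomial_function_in_span_monomial[OF assms(1)]
    unfolding fun_space.span_explicit by blast
  have "\<exists>\<alpha>. m = monomial \<alpha>" if "m \<in> t" for m using t that by blast
  then obtain \<alpha> where \<alpha>: "\<And>m. m \<in> t \<Longrightarrow> m = monomial (\<alpha> m)" by metis
  define d where "d = (\<lambda>m. \<Sum>i\<in>UNIV. \<alpha> m i)"
  have "p x = (\<Sum>m\<in>{m \<in> t. d m = k}. a m * m x)" for x
  proof -
    \<comment> \<open>For fixed \<open>x\<close>, both sides of the homogeneity identity are
      polynomials in the scaling factor \<open>c\<close>. Agreeing for all \<open>c\<close>, they
      have equal coefficients, and the coefficient of index \<open>k\<close> selects the terms of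
      degree \<open>k\<close>.\<close>
    have "poly (\<Sum>m\<in>t. monom (a m * m x) (d m)) c = poly (monom (p x) k) c" for c
    proof -
      have "(\<Sum>m\<in>t. a m * m (c *\<^sub>R x)) = c ^ k * p x"
        using hom[of c x] by (subst (asm) p) (simp only: sum_fun_apply)
      moreover have "m (c *\<^sub>R x) = c ^ d m * m x" if "m \<in> t" for m
        using \<alpha>[OF that] monomial_scaleR d_def by metis
      ultimately have "(\<Sum>m\<in>t. a m * (c ^ d m * m x)) = c ^ k * p x" by simp
      then show ?thesis by (simp add: poly_sum poly_monom mult_ac)
    qed
    then have "(\<Sum>m\<in>t. monom (a m * m x) (d m)) = monom (p x) k"
      by (intro poly_ext) blast
    then have "coeff (\<Sum>m\<in>t. monom (a m * m x) (d m)) k = p x" by simp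
    then show ?thesis using t by (simp add: coeff_sum sum.If_cases Int_def)
  qed
  then have "p = (\<Sum>m\<in>{m \<in> t. d m = k}. (\<lambda>x. a m * m x))"
    by (simp add: fun_eq_iff sum_fun_apply)
  also have "\<dots> \<in> fun_space.span (monomial ` {\<alpha>. (\<Sum>i\<in>UNIV. \<alpha> i) = k})"
    by (intro fun_space.span_sum fun_space.span_scale fun_space.span_base)
      (use \<alpha> in \<open>auto simp: d_def\<close>)
  finally show ?thesis .
qed

text \<open>Exponents of total degree \<open>k\<close> lie in a box with \<open>k + 1\<close>
  choices per coordinate. The count is crude, but any polynomial bound is absorbed by geometric
  decay.\<close>

lemma harmonic_dim_le: "harmonic_dim TYPE('n::finite) k \<le> (k + 1) ^ CARD('n)"
proof -
  let ?A = "PiE UNIV (\<lambda>_::'n. {..k})"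
  have fin: "finite ?A" by (intro finite_PiE) auto
  have "{\<alpha>::'n \<Rightarrow> nat. (\<Sum>i\<in>UNIV. \<alpha> i) = k} \<subseteq> ?A"
    by (auto simp: PiE_def intro: member_le_sum)
  then have "fun_space.span (monomial ` {\<alpha>::'n \<Rightarrow> nat. (\<Sum>i\<in>UNIV. \<alpha> i) = k})
      \<subseteq> fun_space.span (monomial ` ?A)"
    by (intro fun_space.span_mono image_mono)
  then have "harmonic_homogeneous k \<subseteq> fun_space.span (monomial ` ?A)"
    using homogeneous_polynomial_in_span by (fastforce simp: harmonic_homogeneous_def)
  then have "harmonic_dim TYPE('n) k \<le> card (monomial ` ?A)"
    unfolding harmonic_dim_def using fin by (intro fun_space.dim_le_card) auto
  also have "\<dots> \<le> card ?A" by (rule card_image_le[OF fin])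
  also have "\<dots> = (k + 1) ^ CARD('n)" by (simp add: card_PiE)
  finally show ?thesis .
qed

section \<open>Summing blocks of spherical harmonics over a ball\<close>

lemma summable_power_mult_geometric:
  fixes q :: real
  assumes q: "0 < q" "q < 1"
  shows "summable (\<lambda>k. real (k + 1) ^ p * q ^ k)"
proof -
  \<comment> \<open>This is the ratio of consecutive terms. Its limit \<open>q\<close> lies below
    the midpoint \<open>(1 + q) / 2\<close> of \<open>q\<close> and 1, which serves as the bound in
    the ratio test.\<close>
  have "(\<lambda>k. q * (1 + inverse (real (Suc k))) ^ p) \<longlonglongrightarrow> q * 1 ^ p"
    by (intro tendsto_intros LIMSEQ_inverse_real_of_nat_add)
  then have "\<forall>\<^sub>F k in sequentially. q * (1 + inverse (real (Suc k))) ^ p < (1 + q) / 2"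
    by (rule order_tendstoD(2)) (use q in simp)
  then obtain k0 where k0: "\<And>k. k \<ge> k0 \<Longrightarrow> q * (1 + inverse (real (Suc k))) ^ p \<le> (1 + q) / 2"
    unfolding eventually_sequentially by (meson less_imp_le)
  show ?thesis
  proof (rule summable_ratio_test)
    show "(1 + q) / 2 < 1" using q by simp
    fix k assume "k \<ge> k0"
    have "real (Suc k + 1) = (1 + inverse (real (Suc k))) * real (k + 1)"
      by (simp add: distrib_right)
    then have "real (Suc k + 1) ^ p * q ^ Suc k =
        (q * (1 + inverse (real (Suc k))) ^ p) * (real (k + 1) ^ p * q ^ k)"
      by (simp add: power_mult_distrib)
    also have "\<dots> \<le> (1 + q) / 2 * (real (k + 1) ^ p * q ^ k)"
      using q by (intro mult_right_mono k0 \<open>k \<ge> k0\<close>) auto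
    finally show "norm (real (Suc k + 1) ^ p * q ^ Suc k) \<le> (1 + q) / 2 * norm (real (k + 1) ^ p * q ^ k)"
      using q by (simp add: abs_mult)
  qed
qed

text \<open>Extending the terms by zero outside \<open>S\<close> reduces the claim to convergence on
  the whole space.\<close>

lemma L2_convergent_on_series:
  fixes v :: "nat \<Rightarrow> 'a::euclidean_space \<Rightarrow> real"
  assumes q: "0 < q" "q < 1" and S [measurable]: "S \<in> sets lebesgue"
    and meas: "\<And>k. set_borel_measurable lebesgue S (v k)"
    and int: "\<And>k. set_integrable lebesgue S (\<lambda>x. (v k x)\<^sup>2)"
    and sm: "summable (\<lambda>k. (LINT x:S|lebesgue. (v k x)\<^sup>2) / q ^ k)"
  shows "L2_convergent_on S (\<lambda>m x. \<Sum>k<m. v k x)"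
proof -
  define u where "u = (\<lambda>k x. indicator S x *\<^sub>R v k x)"
  have usq: "(u k x)\<^sup>2 = indicator S x *\<^sub>R (v k x)\<^sup>2" for k x
    by (auto simp: u_def indicator_def)
  have [measurable]: "u k \<in> borel_measurable lebesgue" for k
    using meas by (simp add: u_def set_borel_measurable_def)
  have uint: "integrable lebesgue (\<lambda>x. (u k x)\<^sup>2)" for k
    using int by (simp add: usq set_integrable_def)
  have usm: "summable (\<lambda>k. (\<integral>x. (u k x)\<^sup>2 \<partial>lebesgue) / q ^ k)"
    using sm by (simp add: usq set_lebesgue_integral_def)
  obtain g where g [measurable]: "g \<in> borel_measurable lebesgue"
    and g2: "integrable lebesgue (\<lambda>x. (g x)\<^sup>2)"
    and lim: "(\<lambda>m. \<integral>x. ((\<Sum>k<m. u k x) - g x)\<^sup>2 \<partial>lebesgue) \<longlonglongrightarrow> 0"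
    and dint: "\<And>m. integrable lebesgue (\<lambda>x. ((\<Sum>k<m. u k x) - g x)\<^sup>2)"
    by (rule L2_series_convergent[of q u lebesgue]) (use q uint usm in auto)
  have partial: "(\<lambda>x. \<Sum>k<m. v k x) \<in> L2_on S" for m
  proof -
    have "(\<lambda>x. indicator S x *\<^sub>R (\<Sum>k<m. v k x)) = (\<lambda>x. \<Sum>k<m. u k x)"
      by (simp add: u_def sum_distrib_left)
    moreover have "(\<lambda>x. indicator S x *\<^sub>R (\<Sum>k<m. v k x)\<^sup>2) = (\<lambda>x. (\<Sum>k<m. u k x)\<^sup>2)"
      by (auto simp: u_def indicator_def)
    moreover have "integrable lebesgue (\<lambda>x. (\<Sum>k<m. u k x)\<^sup>2)"
    proof (rule Bochner_Integration.integrable_bound)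
      show "integrable lebesgue (\<lambda>x. (\<Sum>k<m. (u k x)\<^sup>2) * card {..<m})"
        using uint by (intro integrable_mult_left Bochner_Integration.integrable_sum) auto
      show "AE x in lebesgue. norm ((\<Sum>k<m. u k x)\<^sup>2) \<le> norm ((\<Sum>k<m. (u k x)\<^sup>2) * card {..<m})"
        using sum_squared_le_sum_of_squares[of "\<lambda>k. u k _" "{..<m}"]
        by (intro AE_I2) (simp add: abs_mult sum_nonneg)
    qed measurable
    ultimately show ?thesis
      by (simp add: L2_on_def set_borel_measurable_def set_integrable_def)
  qed
  have "g \<in> L2_on S"
    using integrable_mult_indicator[OF S g2]
    by (simp add: L2_on_def set_borel_measurable_def set_integrable_def)
  \<comment> \<open>On \<open>S\<close> the functions \<open>u k\<close> and \<open>v k\<close>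
    agree, so the integral over \<open>S\<close> is the whole-space error without the contribution
    from outside \<open>S\<close>.\<close>
  moreover have "(\<lambda>m. LINT x:S|lebesgue. ((\<Sum>k<m. v k x) - g x)\<^sup>2) \<longlonglongrightarrow> 0"
  proof (rule tendsto_sandwich[OF _ _ tendsto_const lim])
    show "\<forall>\<^sub>F m in sequentially. 0 \<le> (LINT x:S|lebesgue. ((\<Sum>k<m. v k x) - g x)\<^sup>2)"
      by (simp add: set_lebesgue_integral_def)
    show "\<forall>\<^sub>F m in sequentially. (LINT x:S|lebesgue. ((\<Sum>k<m. v k x) - g x)\<^sup>2)
        \<le> (\<integral>x. ((\<Sum>k<m. u k x) - g x)\<^sup>2 \<partial>lebesgue)"
    proof (intro always_eventually allI)
      fix m
      have eq: "indicator S x *\<^sub>R ((\<Sum>k<m. v k x) - g x)\<^sup>2 = indicator S x *\<^sub>R ((\<Sum>k<m. u k x) - g x)\<^sup>2" for x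
        by (auto simp: u_def indicator_def)
      show "(LINT x:S|lebesgue. ((\<Sum>k<m. v k x) - g x)\<^sup>2) \<le> (\<integral>x. ((\<Sum>k<m. u k x) - g x)\<^sup>2 \<partial>lebesgue)"
        unfolding set_lebesgue_integral_def eq
        by (intro integral_mono integrable_mult_indicator dint S) (auto simp: indicator_def)
    qed
  qed
  ultimately show ?thesis
    unfolding L2_convergent_on_def using partial by blast
qed

text \<open>Cauchy-Schwarz bounds the squared sum by \<open>card L\<close> times the sum of squares,
  and each square integrates to at most \<open>B\<^sup>2 * V\<close>; this gives the two factors
  \<open>card L\<close>. The radial factors enter only through their common bound
  \<open>B\<close>.\<close>

lemma spherical_block_L2_bound:
  fixes p :: "nat \<Rightarrow> real ^ 'n \<Rightarrow> real"
  assumes R: "R > 0" and L: "finite L"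
    and p: "\<And>l. l \<in> L \<Longrightarrow> p l \<in> borel_measurable borel"
    and one: "\<And>l. l \<in> L \<Longrightarrow> sphere_inner (p l) (p l) = 1"
    and b: "\<And>l. l \<in> L \<Longrightarrow> b l \<in> borel_measurable borel"
    and bB: "\<And>l x. l \<in> L \<Longrightarrow> norm x < R \<Longrightarrow> \<bar>b l x\<bar> \<le> B"
  defines "V \<equiv> R ^ CARD('n) * measure (sphere_measure :: (real ^ 'n) measure) (sphere 0 1) / CARD('n)"
  shows "set_borel_measurable lebesgue (ball 0 R) (\<lambda>x. \<Sum>l\<in>L. b l x * p l (sgn x))"
    and "set_integrable lebesgue (ball 0 R) (\<lambda>x. (\<Sum>l\<in>L. b l x * p l (sgn x))\<^sup>2)"
    and "(LINT x:ball 0 R|lebesgue. (\<Sum>l\<in>L. b l x * p l (sgn x))\<^sup>2) \<le> (real (card L))\<^sup>2 * (B\<^sup>2 * V)"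
proof -
  let ?f = "\<lambda>x. \<Sum>l\<in>L. b l x * p l (sgn x)"
  let ?F = "\<lambda>x. indicator (ball 0 R) x *\<^sub>R (?f x)\<^sup>2"
  let ?G = "\<lambda>x. (\<Sum>l\<in>L. B\<^sup>2 * ((p l (sgn x))\<^sup>2 * indicator (ball 0 R) x)) * card L"
  have [measurable]: "ball (0::real^'n) R \<in> sets borel" by simp
  have "(\<lambda>x. p l (sgn x)) \<in> borel_measurable borel" if "l \<in> L" for l
    by (rule measurable_compose[OF borel_measurable_sgn p[OF that]])
  then have f [measurable]: "?f \<in> borel_measurable borel"
    using b by (intro borel_measurable_sum borel_measurable_times) auto
  have Fm: "?F \<in> borel_measurable lborel" by measurable
  have le: "?F x \<le> ?G x" for x
  proof (cases "x \<in> ball 0 R")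
    case True
    have "(?f x)\<^sup>2 \<le> (\<Sum>l\<in>L. (b l x * p l (sgn x))\<^sup>2) * card L"
      by (rule sum_squared_le_sum_of_squares)
    also have "\<dots> \<le> (\<Sum>l\<in>L. B\<^sup>2 * (p l (sgn x))\<^sup>2) * card L"
    proof (intro mult_right_mono sum_mono)
      fix l assume "l \<in> L"
      then have "\<bar>b l x\<bar> \<le> B" using bB True by simp
      then have "(b l x)\<^sup>2 \<le> B\<^sup>2" by (metis abs_ge_zero power2_abs power_mono)
      then show "(b l x * p l (sgn x))\<^sup>2 \<le> B\<^sup>2 * (p l (sgn x))\<^sup>2"
        by (simp add: power_mult_distrib mult_right_mono)
    qed simp
    finally show ?thesis using True by simp
  qed simp
  note ball = sphere_inner_one_integral_ball[OF p one R]
  have Gint: "integrable lborel ?G"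
    by (intro integrable_mult_left Bochner_Integration.integrable_sum integrable_mult_right ball(1))
  have "(\<integral>x. ?G x \<partial>lborel) =
      (\<Sum>l\<in>L. B\<^sup>2 * (\<integral>x. (p l (sgn x))\<^sup>2 * indicator (ball 0 R) x \<partial>lborel)) * card L"
    using ball(1) by (subst integral_mult_left_zero, subst Bochner_Integration.integral_sum) auto
  also have "\<dots> = (\<Sum>l\<in>L. B\<^sup>2 * V) * card L"
    unfolding V_def using ball(2) by (intro arg_cong2[where f = "(*)"] sum.cong) auto
  also have "\<dots> = (real (card L))\<^sup>2 * (B\<^sup>2 * V)"
    by (simp add: power2_eq_square)
  finally have GV: "(\<integral>x. ?G x \<partial>lborel) = (real (card L))\<^sup>2 * (B\<^sup>2 * V)" .
  have Fint: "integrable lborel ?F"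
  proof (rule Bochner_Integration.integrable_bound[OF Gint Fm], rule AE_I2)
    fix x
    have "0 \<le> ?F x" by simp
    then show "norm (?F x) \<le> norm (?G x)"
      using le[of x] unfolding real_norm_def by linarith
  qed
  show "set_borel_measurable lebesgue (ball 0 R) ?f"
    unfolding set_borel_measurable_def by (rule measurable_completion) measurable
  show "set_integrable lebesgue (ball 0 R) (\<lambda>x. (?f x)\<^sup>2)"
    unfolding set_integrable_def using Fint Fm by (simp only: integrable_completion)
  have "(LINT x:ball 0 R|lebesgue. (?f x)\<^sup>2) = (\<integral>x. ?F x \<partial>lborel)"
    unfolding set_lebesgue_integral_def using Fm by (rule integral_completion)
  also have "\<dots> \<le> (\<integral>x. ?G x \<partial>lborel)"
    by (rule integral_mono[OF Fint Gint le])
  finally show "(LINT x:ball 0 R|lebesgue. (?f x)\<^sup>2) \<le> (real (card L))\<^sup>2 * (B\<^sup>2 * V)"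
    unfolding GV .
qed

lemma spherical_harmonic_basis_measurable:
  assumes "spherical_harmonic_basis Y" "l \<in> {1..harmonic_dim TYPE('n::finite) k}"
  shows "(Y k l :: real ^ 'n \<Rightarrow> real) \<in> borel_measurable borel"
proof -
  have "Y k l \<in> fun_space.span (Y k ` {1..harmonic_dim TYPE('n) k})"
    using assms(2) by (intro fun_space.span_base) blast
  then have "Y k l \<in> harmonic_homogeneous k"
    using assms(1) unfolding spherical_harmonic_basis_def Let_def by metis
  then have "real_polynomial_function (Y k l)" by (simp add: harmonic_homogeneous_def)
  then show ?thesis
    by (intro borel_measurable_continuous_onI continuous_at_imp_continuous_on ballI
        continuous_real_polymonial_function)
qed

section \<open>Convergence of the interpolating series\<close>

theorem theorem4:
  fixes f :: "real ^ 'n \<Rightarrow> real"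
    and Y :: "nat \<Rightarrow> nat \<Rightarrow> real ^ 'n \<Rightarrow> real"
    and h :: "nat \<Rightarrow> nat \<Rightarrow> real poly"
    and N :: nat
    and R K :: real
    and r \<eta> :: "nat \<Rightarrow> real"
  assumes "CARD('n) \<ge> 2" and "N \<ge> 1" and "R > 0"
    and "spherical_harmonic_basis Y"
    and "\<exists>U. open U \<and> closure (ball 0 R) \<subseteq> U \<and> real_analytic_on f U"
    and "0 < r 1" and "strict_mono_on {1..N} r" and "r N \<le> R"
    and "K > 0" and "\<And>j. j \<in> {1..N} \<Longrightarrow> \<eta> j > 0"
    and "\<And>k l j. l \<in> {1..harmonic_dim TYPE('n) k} \<Longrightarrow> j \<in> {1..N} \<Longrightarrow>
           \<bar>spherical_coeff Y (\<lambda>\<theta>. f (r j *\<^sub>R \<theta>)) k l\<bar> \<le> K * exp (- \<eta> j * real k)"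
    and "R * Max ((\<lambda>j. exp (- \<eta> j) / r j) ` {1..N}) < 1"
    and "\<And>k l. l \<in> {1..harmonic_dim TYPE('n) k} \<Longrightarrow> degree (h k l) \<le> N - 1"
    and "\<And>k l j. l \<in> {1..harmonic_dim TYPE('n) k} \<Longrightarrow> j \<in> {1..N} \<Longrightarrow>
           r j ^ k * poly (h k l) ((r j)\<^sup>2) = spherical_coeff Y (\<lambda>\<theta>. f (r j *\<^sub>R \<theta>)) k l"
  shows "L2_convergent_on (ball 0 R) (polyharmonic_partial_sum Y h)"
proof -
  let ?L = "\<lambda>k. {1..harmonic_dim TYPE('n) k}"
  define M where "M = Max ((\<lambda>j. exp (- \<eta> j) / r j) ` {1..N})"
  define q where "q = R * M"
  have M: "exp (- \<eta> j) / r j \<le> M" if "j \<in> {1..N}" for j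
    unfolding M_def using that by (intro Max_ge) auto
  have rpos: "0 < r j" if "j \<in> {1..N}" for j
    using strict_mono_on_leD[OF assms(7), of 1 j] that assms(6) by auto
  have "0 < exp (- \<eta> 1) / r 1" using assms(6) by simp
  then have Mpos: "M > 0" using M[of 1] assms(2) by force
  have q: "0 < q" "q < 1" using Mpos assms(3,12) by (auto simp: q_def M_def)
  \<comment> \<open>Dividing the interpolation condition by \<open>r j ^ k\<close> turns the decay
    \<open>exp (- \<eta> j * real k)\<close> into the \<open>k\<close>-th power of
    \<open>exp (- \<eta> j) / r j\<close>, which is at most \<open>M\<close>.\<close>
  have node: "\<bar>poly (h k l) ((r j)\<^sup>2)\<bar> \<le> K * M ^ k" if "l \<in> ?L k" "j \<in> {1..N}" for k l j
  proof -
    have rk: "r j ^ k > 0" using rpos that by simp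
    have "r j ^ k * \<bar>poly (h k l) ((r j)\<^sup>2)\<bar> = \<bar>spherical_coeff Y (\<lambda>\<theta>. f (r j *\<^sub>R \<theta>)) k l\<bar>"
      using assms(14)[OF that, symmetric] rk by (simp add: abs_mult)
    also have "\<dots> \<le> K * exp (- \<eta> j * real k)" by (rule assms(11)[OF that])
    also have "exp (- \<eta> j * real k) = exp (- \<eta> j) ^ k"
      using exp_of_nat_mult[of k "- \<eta> j"] by (simp add: mult.commute)
    finally have "\<bar>poly (h k l) ((r j)\<^sup>2)\<bar> \<le> K * (exp (- \<eta> j) / r j) ^ k"
      using rk by (simp add: power_divide field_simps)
    also have "\<dots> \<le> K * M ^ k"
      using M[OF that(2)] rpos[OF that(2)] assms(9) by (intro mult_left_mono power_mono) auto
    finally show ?thesis .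
  qed
  define A where "A = (\<lambda>j. (r j)\<^sup>2) ` {1..N}"
  have "inj_on (\<lambda>j. (r j)\<^sup>2) {1..N}"
  proof (rule inj_onI)
    fix i j assume ij: "i \<in> {1..N}" "j \<in> {1..N}" "(r i)\<^sup>2 = (r j)\<^sup>2"
    then have "r i = r j" using rpos by (metis less_imp_le power2_eq_imp_eq)
    then show "i = j" using strict_mono_on_imp_inj_on[OF assms(7)] ij by (auto dest: inj_onD)
  qed
  then have cardA: "card A = N" unfolding A_def by (simp add: card_image)
  have "finite A" by (simp add: A_def)
  then obtain C where "C \<ge> 0" and C: "\<And>p B t. p = 0 \<or> degree p < card A \<Longrightarrow> B \<ge> 0 \<Longrightarrow>
      (\<And>a. a \<in> A \<Longrightarrow> \<bar>poly p a\<bar> \<le> B) \<Longrightarrow> \<bar>t\<bar> \<le> R\<^sup>2 \<Longrightarrow> \<bar>poly p t\<bar> \<le> C * B"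
    by (rule poly_bounded_by_node_values[where T = "R\<^sup>2"]) blast
  \<comment> \<open>The constant \<open>C\<close> depends only on the nodes and on \<open>R\<close>,
    hence serves all \<open>k\<close> and \<open>l\<close>. The factor \<open>R ^ k\<close> from
    \<open>norm x ^ k\<close> combines with \<open>M ^ k\<close> to \<open>q ^ k\<close>.\<close>
  have coeff: "\<bar>poly (h k l) ((norm x)\<^sup>2) * norm x ^ k\<bar> \<le> C * K * q ^ k"
    if l: "l \<in> ?L k" and x: "norm x < R" for k l and x :: "real ^ 'n"
  proof -
    have "\<bar>poly (h k l) ((norm x)\<^sup>2)\<bar> \<le> C * (K * M ^ k)"
    proof (rule C)
      have "degree (h k l) < N" using assms(13)[OF l] assms(2) by linarith
      then show "h k l = 0 \<or> degree (h k l) < card A" using cardA by simp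
      show "\<bar>poly (h k l) a\<bar> \<le> K * M ^ k" if "a \<in> A" for a
        using that node[OF l] by (auto simp: A_def)
      show "\<bar>(norm x)\<^sup>2\<bar> \<le> R\<^sup>2" using x by (simp add: power_mono)
    qed (use assms(9) Mpos in simp)
    moreover have "norm x ^ k \<le> R ^ k" using x by (intro power_mono) auto
    ultimately have "\<bar>poly (h k l) ((norm x)\<^sup>2)\<bar> * norm x ^ k \<le> C * (K * M ^ k) * R ^ k"
      using \<open>C \<ge> 0\<close> assms(9) Mpos by (intro mult_mono) auto
    then show ?thesis by (simp add: abs_mult q_def power_mult_distrib mult_ac)
  qed
  define V where "V = R ^ CARD('n) * measure (sphere_measure :: (real ^ 'n) measure) (sphere 0 1) / CARD('n)"
  define v where "v = (\<lambda>k x. \<Sum>l\<in>?L k. poly (h k l) ((norm x)\<^sup>2) * norm x ^ k * Y k l (sgn x))"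
  have one: "sphere_inner (Y k l) (Y k l) = 1" if "l \<in> ?L k" for k l
    using assms(4) that unfolding spherical_harmonic_basis_def Let_def by simp
  have bm: "(\<lambda>x::real^'n. poly (h k l) ((norm x)\<^sup>2) * norm x ^ k) \<in> borel_measurable borel" for k l
    by (intro borel_measurable_continuous_onI continuous_intros)
  \<comment> \<open>The factor \<open>b\<close> is the radial part
    \<open>poly (h k l) ((norm x)\<^sup>2) * norm x ^ k\<close>, with
    \<open>B = C * K * q ^ k\<close> taken from \<open>coeff\<close>.\<close>
  note block = spherical_block_L2_bound[OF assms(3) finite_atLeastAtMost
      spherical_harmonic_basis_measurable[OF assms(4)] one bm coeff, folded v_def V_def]
  have sm: "summable (\<lambda>k. (LINT x:ball 0 R|lebesgue. (v k x)\<^sup>2) / q ^ k)"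
  proof (rule summable_comparison_test')
    \<comment> \<open>The squared block norm carries \<open>q ^ k\<close> twice: one factor cancels
      the weight, the other makes the series converge. The exponent \<open>2 * CARD('n)\<close>
      comes from the squared dimension bound.\<close>
    show "summable (\<lambda>k. (C * K)\<^sup>2 * V * (real (k + 1) ^ (2 * CARD('n)) * q ^ k))"
      by (intro summable_mult summable_power_mult_geometric q)
    fix k :: nat
    have "V \<ge> 0" using assms(3) by (simp add: V_def)
    have "real (harmonic_dim TYPE('n) k) \<le> real (k + 1) ^ CARD('n)"
      using harmonic_dim_le[where 'n = 'n, of k] by (metis of_nat_le_iff of_nat_power)
    then have d: "(real (harmonic_dim TYPE('n) k))\<^sup>2 \<le> real (k + 1) ^ (2 * CARD('n))"
      unfolding mult.commute[of 2] power_mult by (rule power_mono) simp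
    have "(LINT x:ball 0 R|lebesgue. (v k x)\<^sup>2)
        \<le> (real (card (?L k)))\<^sup>2 * ((C * K * q ^ k)\<^sup>2 * V)"
      unfolding v_def by (rule block(3)[unfolded v_def])
    also have "\<dots> \<le> real (k + 1) ^ (2 * CARD('n)) * ((C * K * q ^ k)\<^sup>2 * V)"
      using d \<open>V \<ge> 0\<close> by (intro mult_right_mono) auto
    also have "\<dots> = (C * K)\<^sup>2 * V * (real (k + 1) ^ (2 * CARD('n)) * q ^ k) * q ^ k"
      by (simp add: power2_eq_square mult_ac)
    finally have "(LINT x:ball 0 R|lebesgue. (v k x)\<^sup>2) / q ^ k
        \<le> (C * K)\<^sup>2 * V * (real (k + 1) ^ (2 * CARD('n)) * q ^ k)"
      using q by (simp add: pos_divide_le_eq)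
    moreover have "0 \<le> (LINT x:ball 0 R|lebesgue. (v k x)\<^sup>2) / q ^ k"
      using q by (simp add: set_lebesgue_integral_def)
    ultimately show "norm ((LINT x:ball 0 R|lebesgue. (v k x)\<^sup>2) / q ^ k)
        \<le> (C * K)\<^sup>2 * V * (real (k + 1) ^ (2 * CARD('n)) * q ^ k)"
      by simp
  qed
  have "polyharmonic_partial_sum Y h = (\<lambda>m x. \<Sum>k<m. v k x)"
    by (simp add: fun_eq_iff polyharmonic_partial_sum_def v_def)
  moreover have "L2_convergent_on (ball 0 R) (\<lambda>m x. \<Sum>k<m. v k x)"
  proof (rule L2_convergent_on_series[OF q _ _ _ sm])
    show "set_borel_measurable lebesgue (ball 0 R) (v k)"
      and "set_integrable lebesgue (ball 0 R) (\<lambda>x. (v k x)\<^sup>2)" for k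
      unfolding v_def by (rule block[unfolded v_def]; assumption)+
  qed simp
  ultimately show ?thesis by simp
qed

end
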